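(* Let $\{T_i\}_{i\in I}\subseteq X_F^{*}$ be a $p$-frame associated to $(a_2,\dots,a_n)$ for $X$ with bounds $A$ and $B$. Let $R\ne 0$ be any element of $X_F^{*}$ and let $\{c_i\}_{i\in I}$ be any sequence of scalars. Then the perturbed sequence of bounded $b$-linear functionals $\{T_i+c_iR\}_{i\in I}$ is a $p$-frame associated to $(a_2,\dots,a_n)$ for $X$ if $$\sum_{i\in I}|c_i|^p<\frac{A}{\|R\|^p}.$$
   Context: Let $\mathbb K\in\{\mathbb R,\mathbb C\}$, $n\ge 2$, $p\in(1,\infty)$, and let $I$ be a countable index set. An $n$-norm on a linear space $X$ over $\mathbb K$ is a map $\|\cdot,\dots,\cdot\|_X:X^n\to\mathbb R$ such that (i) $\|x_1,\dots,x_n\|_X=0$ iff $x_1,\dots,x_n$ are linearly dependent; (ii) it is invariant under permutations of its arguments; (iii) $\|\alpha x_1,x_2,\dots,x_n\|_X=|\alpha|\,\|x_1,\dots,x_n\|_X$ for $\alpha\in\mathbb K$; (iv) $\|x+y,x_2,\dots,x_n\|_X\le\|x,x_2,\dots,x_n\|_X+\|y,x_2,\dots,x_n\|_X$. A sequence $\{x_k\}$ converges to $x$ if $\|x_k-x,x_2,\dots,x_n\|_X\to0$ for all $x_2,\dots,x_n\in X$, and is Cauchy if $\|x_l-x_k,x_2,\dots,x_n\|_X\to0$ as $l,k\to\infty$ for all $x_2,\dots,x_n\in X$; $X$ is an $n$-Banach space if every Cauchy sequence converges. $X$ is an $n$-Banach space and $a_2,\dots,a_n\in X$ are fixed. A bounded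 $b$-linear functional on $X\times\langle a_2\rangle\times\cdots\times\langle a_n\rangle$ ($\langle a_i\rangle$ is the subspace generated by $a_i$) is a map $T$ from this set to $\mathbb K$ with $T(x+y,a_2,\dots,a_n)=T(x,a_2,\dots,a_n)+T(y,a_2,\dots,a_n)$, $T(kx,a_2,\dots,a_n)=kT(x,a_2,\dots,a_n)$ for $x,y\in X$, $k\in\mathbb K$, and for which there is $M>0$ with $|T(x,a_2,\dots,a_n)|\le M\|x,a_2,\dots,a_n\|_X$ for all $x\in X$; its norm $\|T\|$ is the infimum of such $M$. $X_F^{*}$ is the Banach space of all of these, functionals with the same values at all $(x,a_2,\dots,a_n)$, $x\in X$, being identified. A countable family $\{T_i\}_{i\in I}\subseteq X_F^{*}$ is a $p$-frame associated to $(a_2,\dots,a_n)$ for $X$ (with bounds $A,B$) if there are constants $A,B>0$ with $A\|x,a_2,\dots,a_n\|_X^p\le\sum_{i\in I}|T_i(x,a_2,\dots,a_n)|^p\le B\|x,a_2,\dots,a_n\|_X^p$ for all $x\in X$. *)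

theory Defs
  imports "HOL-Analysis.Analysis" "HOL-Library.Multiset"
begin

text \<open>
  The scalar field is a type of class \<^class>\<open>real_normed_field\<close>, which has both \<^typ>\<open>real\<close> and
  \<^typ>\<open>complex\<close> as instances; by the Gelfand-Mazur theorem these are, up to isometric isomorphism,
  the only ones. The linear space is the whole type \<open>'x\<close> with scalar multiplication \<open>smul\<close>.
  An \<open>n\<close>-tuple is a list of length \<open>n\<close>; an \<open>n\<close>-norm is a function on lists of which only the values
  at lists of length \<open>n\<close> matter.

  The tuple \<open>xs\<close> is linearly dependent iff it has a repeated entry or its set of entries is
  dependent (the notion \<open>dependent\<close> of the library is about sets and does not see repetitions).
\<close>

locale n_normed_space = vector_space smul
  for smul :: "'k::real_normed_field \<Rightarrow> 'x::ab_group_add \<Rightarrow> 'x" +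
  fixes n :: nat and nnorm :: "'x list \<Rightarrow> real"
  assumes n_ge_2: "n \<ge> 2"
    and nnorm_eq_0_iff:
      "length xs = n \<Longrightarrow> nnorm xs = 0 \<longleftrightarrow> \<not> distinct xs \<or> dependent (set xs)"
    and nnorm_perm:
      "length xs = n \<Longrightarrow> mset ys = mset xs \<Longrightarrow> nnorm ys = nnorm xs"
    and nnorm_scale:
      "length xs = n - 1 \<Longrightarrow> nnorm (smul \<alpha> x # xs) = norm \<alpha> * nnorm (x # xs)"
    and nnorm_triangle:
      "length xs = n - 1 \<Longrightarrow> nnorm ((x + y) # xs) \<le> nnorm (x # xs) + nnorm (y # xs)"

definition n_converges_to ::
    "nat \<Rightarrow> ('x::ab_group_add list \<Rightarrow> real) \<Rightarrow> (nat \<Rightarrow> 'x) \<Rightarrow> 'x \<Rightarrow> bool" where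
  "n_converges_to n nnorm u x \<longleftrightarrow>
     (\<forall>xs. length xs = n - 1 \<longrightarrow> (\<lambda>k. nnorm ((u k - x) # xs)) \<longlonglongrightarrow> 0)"

definition n_Cauchy :: "nat \<Rightarrow> ('x::ab_group_add list \<Rightarrow> real) \<Rightarrow> (nat \<Rightarrow> 'x) \<Rightarrow> bool" where
  "n_Cauchy n nnorm u \<longleftrightarrow>
     (\<forall>xs. length xs = n - 1 \<longrightarrow>
       ((\<lambda>(l, k). nnorm ((u l - u k) # xs)) \<longlongrightarrow> 0) (sequentially \<times>\<^sub>F sequentially))"

locale n_Banach_space = n_normed_space +
  assumes n_complete: "n_Cauchy n nnorm u \<Longrightarrow> \<exists>x. n_converges_to n nnorm u x"

text \<open>
  Below, \<open>a\<close> is the list \<open>[a\<^sub>2, \<dots>, a\<^sub>n]\<close>. A map on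
  \<open>X \<times> \<langle>a\<^sub>2\<rangle> \<times> \<cdots> \<times> \<langle>a\<^sub>n\<rangle>\<close> is represented by any total function on lists extending it; every
  notion below only involves the values at \<open>x # a\<close>. The set \<open>b_dual\<close> contains these representatives,
  and \<open>b_eq\<close> is the identification made in the space \<open>X\<^sub>F\<^sup>*\<close>.
\<close>

definition b_bound ::
    "('x list \<Rightarrow> real) \<Rightarrow> 'x list \<Rightarrow> ('x list \<Rightarrow> 'k::real_normed_field) \<Rightarrow> real \<Rightarrow> bool" where
  "b_bound nnorm a T M \<longleftrightarrow> M > 0 \<and> (\<forall>x. norm (T (x # a)) \<le> M * nnorm (x # a))"

definition b_dual ::
    "('k::real_normed_field \<Rightarrow> 'x::ab_group_add \<Rightarrow> 'x) \<Rightarrow> ('x list \<Rightarrow> real) \<Rightarrow> 'x list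
      \<Rightarrow> ('x list \<Rightarrow> 'k) set" where
  "b_dual smul nnorm a =
     {T. (\<forall>x y. T ((x + y) # a) = T (x # a) + T (y # a)) \<and>
         (\<forall>k x. T (smul k x # a) = k * T (x # a)) \<and>
         (\<exists>M. b_bound nnorm a T M)}"

definition b_eq :: "'x list \<Rightarrow> ('x list \<Rightarrow> 'k) \<Rightarrow> ('x list \<Rightarrow> 'k) \<Rightarrow> bool" where
  "b_eq a S T \<longleftrightarrow> (\<forall>x. S (x # a) = T (x # a))"

definition b_norm ::
    "('x list \<Rightarrow> real) \<Rightarrow> 'x list \<Rightarrow> ('x list \<Rightarrow> 'k::real_normed_field) \<Rightarrow> real" where
  "b_norm nnorm a T = Inf {M. b_bound nnorm a T M}"

text \<open>
  Summability is required explicitly, since \<^const>\<open>infsum\<close> is \<open>0\<close> for a divergent sum.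
\<close>

definition p_frame_with_bounds ::
    "('k::real_normed_field \<Rightarrow> 'x::ab_group_add \<Rightarrow> 'x) \<Rightarrow> ('x list \<Rightarrow> real) \<Rightarrow> 'x list
      \<Rightarrow> real \<Rightarrow> 'i set \<Rightarrow> ('i \<Rightarrow> 'x list \<Rightarrow> 'k) \<Rightarrow> real \<Rightarrow> real \<Rightarrow> bool" where
  "p_frame_with_bounds smul nnorm a p I T A B \<longleftrightarrow>
     countable I \<and> (\<forall>i\<in>I. T i \<in> b_dual smul nnorm a) \<and> A > 0 \<and> B > 0 \<and>
     (\<forall>x. (\<lambda>i. norm (T i (x # a)) powr p) summable_on I \<and>
          A * nnorm (x # a) powr p \<le> (\<Sum>\<^sub>\<infinity>i\<in>I. norm (T i (x # a)) powr p) \<and>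
          (\<Sum>\<^sub>\<infinity>i\<in>I. norm (T i (x # a)) powr p) \<le> B * nnorm (x # a) powr p)"

definition p_frame ::
    "('k::real_normed_field \<Rightarrow> 'x::ab_group_add \<Rightarrow> 'x) \<Rightarrow> ('x list \<Rightarrow> real) \<Rightarrow> 'x list
      \<Rightarrow> real \<Rightarrow> 'i set \<Rightarrow> ('i \<Rightarrow> 'x list \<Rightarrow> 'k) \<Rightarrow> bool" where
  "p_frame smul nnorm a p I T \<longleftrightarrow> (\<exists>A B. p_frame_with_bounds smul nnorm a p I T A B)"

lemma b_eq_b_dual: "b_eq a S T \<Longrightarrow> S \<in> b_dual smul nnorm a \<longleftrightarrow> T \<in> b_dual smul nnorm a"
  by (simp add: b_eq_def b_dual_def b_bound_def)

lemma b_eq_b_norm: "b_eq a S T \<Longrightarrow> b_norm nnorm a S = b_norm nnorm a T"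
  by (simp add: b_eq_def b_norm_def b_bound_def)

lemma b_eq_p_frame_with_bounds:
  assumes "\<And>i. i \<in> I \<Longrightarrow> b_eq a (S i) (T i)"
  shows "p_frame_with_bounds smul nnorm a p I S A B \<longleftrightarrow>
         p_frame_with_bounds smul nnorm a p I T A B"
proof -
  have eq: "norm (S i (x # a)) powr p = norm (T i (x # a)) powr p" if "i \<in> I" for i x
    using assms[OF that] by (simp add: b_eq_def)
  have "(\<lambda>i. norm (S i (x # a)) powr p) summable_on I \<longleftrightarrow>
        (\<lambda>i. norm (T i (x # a)) powr p) summable_on I" for x
    using eq by (rule summable_on_cong)
  moreover have "(\<Sum>\<^sub>\<infinity>i\<in>I. norm (S i (x # a)) powr p) =
                 (\<Sum>\<^sub>\<infinity>i\<in>I. norm (T i (x # a)) powr p)" for x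
    using eq by (rule infsum_cong)
  moreover have "(\<forall>i\<in>I. S i \<in> b_dual smul nnorm a) \<longleftrightarrow> (\<forall>i\<in>I. T i \<in> b_dual smul nnorm a)"
    using assms b_eq_b_dual by blast
  ultimately show ?thesis
    by (simp add: p_frame_with_bounds_def)
qed

end

theory Submission
  imports Defs
begin

text \<open>
  For \<open>x \<in> X\<close> the frame inequalities say that the \<open>\<ell>\<^sup>p\<close> norm of the family \<open>(T\<^sub>i x)\<close> lies between
  \<open>A\<^bsup>1/p\<^esup> \<parallel>x\<parallel>\<close> and \<open>B\<^bsup>1/p\<^esup> \<parallel>x\<parallel>\<close>, where \<open>\<parallel>x\<parallel>\<close> abbreviates the \<open>n\<close>-norm of \<open>(x, a\<^sub>2, \<dots>, a\<^sub>n)\<close>.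
  The family \<open>(c\<^sub>i R x)\<close> has \<open>\<ell>\<^sup>p\<close> norm at most \<open>\<gamma> \<parallel>x\<parallel>\<close>, where
  \<open>\<gamma> = (\<Sum> |c\<^sub>i|\<^sup>p)\<^bsup>1/p\<^esup> \<parallel>R\<parallel>\<close>, and the hypothesis says exactly that \<open>\<gamma> < A\<^bsup>1/p\<^esup>\<close>. By Minkowski's
  inequality for \<open>\<ell>\<^sup>p\<close> (lemma \<open>Minkowski_infsum\<close>, used once for the sum and once for the
  difference), \<open>(T\<^sub>i x + c\<^sub>i R x)\<close> has \<open>\<ell>\<^sup>p\<close> norm between \<open>(A\<^bsup>1/p\<^esup> - \<gamma>) \<parallel>x\<parallel>\<close> and
  \<open>(B\<^bsup>1/p\<^esup> + \<gamma>) \<parallel>x\<parallel>\<close>.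

  Minkowski's inequality itself follows, term by term, from the convexity of \<open>t \<mapsto> t\<^sup>p\<close>.
\<close>

text \<open>The point \<open>0\<close> is excluded from \<open>powr_convex\<close>, but is needed here since terms may vanish.\<close>

lemma powr_convex_nonneg:
  fixes p t x y :: real
  assumes "1 \<le> p" "0 \<le> t" "t \<le> 1" "0 \<le> x" "0 \<le> y"
  shows "((1 - t) * x + t * y) powr p \<le> (1 - t) * x powr p + t * y powr p"
proof -
  have scale: "(s * z) powr p \<le> s * z powr p" if "0 \<le> s" "s \<le> 1" for s z :: real
  proof -
    have "s powr p \<le> s powr 1" if "s \<noteq> 0"
      using \<open>0 \<le> s\<close> \<open>s \<le> 1\<close> that assms(1) by (intro powr_mono') auto
    then have "s powr p \<le> s"
      using \<open>0 \<le> s\<close> by (cases "s = 0") auto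
    then show ?thesis
      by (simp add: powr_mult mult_right_mono)
  qed
  consider "x = 0" | "y = 0" | "0 < x" "0 < y"
    using assms(4,5) by fastforce
  then show ?thesis
  proof cases
    case 1
    then show ?thesis using scale[of t y] assms by simp
  next
    case 2
    then show ?thesis using scale[of "1 - t" x] assms by simp
  next
    case 3
    then show ?thesis
      using convex_onD[OF powr_convex[OF assms(1)], of t x y] assms by simp
  qed
qed

text \<open>
  The pointwise form of Minkowski's inequality: after summation, with \<open>S\<close> and \<open>T\<close> bounds for the
  two norms, the right-hand side becomes at most \<open>(S + T)\<^sup>p\<close>.
\<close>

lemma add_powr_le_weighted:
  fixes p a b S T :: real
  assumes "1 \<le> p" "0 \<le> a" "0 \<le> b" "0 < S" "0 < T"
  shows "(a + b) powr p
    \<le> (S + T) powr p * (S / (S + T) / S powr p * a powr p + T / (S + T) / T powr p * b powr p)"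
proof -
  define t where "t = T / (S + T)"
  have t: "0 \<le> t" "t \<le> 1" "1 - t = S / (S + T)"
    using assms by (auto simp: t_def field_simps)
  have "(1 - t) * (a / S) + t * (b / T) = (a + b) / (S + T)"
    unfolding t(3) unfolding t_def using assms by (simp add: add_divide_distrib)
  then have "a + b = (S + T) * ((1 - t) * (a / S) + t * (b / T))"
    using assms by simp
  then have "(a + b) powr p = (S + T) powr p * ((1 - t) * (a / S) + t * (b / T)) powr p"
    by (simp add: powr_mult)
  also have "\<dots> \<le> (S + T) powr p * ((1 - t) * (a / S) powr p + t * (b / T) powr p)"
    using assms t by (intro mult_left_mono powr_convex_nonneg) auto
  finally show ?thesis
    unfolding t(3) unfolding t_def using assms by (simp add: powr_divide)
qed

lemma Minkowski_infsum:
  fixes f g :: "'i \<Rightarrow> 'k::real_normed_vector" and p :: real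
  assumes p: "1 \<le> p"
    and f: "(\<lambda>i. norm (f i) powr p) summable_on I"
    and g: "(\<lambda>i. norm (g i) powr p) summable_on I"
  shows Minkowski_summable_on: "(\<lambda>i. norm (f i + g i) powr p) summable_on I"
    and Minkowski_infsum_le: "(\<Sum>\<^sub>\<infinity>i\<in>I. norm (f i + g i) powr p) powr (1 / p)
      \<le> (\<Sum>\<^sub>\<infinity>i\<in>I. norm (f i) powr p) powr (1 / p) + (\<Sum>\<^sub>\<infinity>i\<in>I. norm (g i) powr p) powr (1 / p)"
proof -
  define h where "h S T i = (S + T) powr p *
    (S / (S + T) / S powr p * norm (f i) powr p + T / (S + T) / T powr p * norm (g i) powr p)"
    for S T :: real and i
  have h_summable: "h S T summable_on I" for S T
    unfolding h_def by (intro summable_on_cmult_right summable_on_add f g)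
  have le_h: "norm (f i + g i) powr p \<le> h S T i" if "0 < S" "0 < T" for S T i
  proof -
    have "norm (f i + g i) powr p \<le> (norm (f i) + norm (g i)) powr p"
      using p by (intro powr_mono2 norm_triangle_ineq) auto
    also have "\<dots> \<le> h S T i"
      unfolding h_def using that p by (intro add_powr_le_weighted) auto
    finally show ?thesis .
  qed
  show summable: "(\<lambda>i. norm (f i + g i) powr p) summable_on I"
    by (rule summable_on_comparison_test[OF h_summable[of 1 1]]) (use le_h in auto)
  define F where "F = (\<Sum>\<^sub>\<infinity>i\<in>I. norm (f i) powr p)"
  define G where "G = (\<Sum>\<^sub>\<infinity>i\<in>I. norm (g i) powr p)"
  have FG: "0 \<le> F" "0 \<le> G"
    unfolding F_def G_def by (auto intro: infsum_nonneg)
  have "(\<Sum>\<^sub>\<infinity>i\<in>I. norm (f i + g i) powr p) powr (1 / p) \<le> F powr (1 / p) + G powr (1 / p)"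
  proof (rule field_le_epsilon)
    fix e :: real assume "0 < e"
    \<comment> \<open>The convexity weights need positive \<open>S\<close> and \<open>T\<close>, but one of the norms may be \<open>0\<close>.\<close>
    define S where "S = F powr (1 / p) + e / 2"
    define T where "T = G powr (1 / p) + e / 2"
    have pos: "0 < S" "0 < T"
      unfolding S_def T_def using \<open>0 < e\<close> by (auto intro: add_nonneg_pos)
    have "(F powr (1 / p)) powr p \<le> S powr p" "(G powr (1 / p)) powr p \<le> T powr p"
      using \<open>0 < e\<close> p by (auto simp: S_def T_def intro!: powr_mono2)
    then have le: "F \<le> S powr p" "G \<le> T powr p"
      using FG p by (auto simp: powr_powr)
    have "(\<Sum>\<^sub>\<infinity>i\<in>I. norm (f i + g i) powr p) \<le> infsum (h S T) I"
      using le_h pos by (intro infsum_mono summable h_summable)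
    also have "infsum (h S T) I =
        (S + T) powr p * (S / (S + T) / S powr p * F + T / (S + T) / T powr p * G)"
      unfolding h_def F_def G_def
      by (simp only: infsum_cmult_right' infsum_add summable_on_cmult_right f g)
    also have "\<dots> \<le> (S + T) powr p * (S / (S + T) / S powr p * S powr p
                                      + T / (S + T) / T powr p * T powr p)"
      using pos le by (intro mult_left_mono add_mono) auto
    also have "\<dots> = (S + T) powr p"
      using pos by (simp add: add_divide_distrib[symmetric])
    finally have "(\<Sum>\<^sub>\<infinity>i\<in>I. norm (f i + g i) powr p) powr (1 / p) \<le> ((S + T) powr p) powr (1 / p)"
      using p by (intro powr_mono2 infsum_nonneg) auto
    also have "\<dots> = F powr (1 / p) + G powr (1 / p) + e"
      using p pos by (simp add: powr_powr) (simp add: S_def T_def)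
    finally show "(\<Sum>\<^sub>\<infinity>i\<in>I. norm (f i + g i) powr p) powr (1 / p)
      \<le> F powr (1 / p) + G powr (1 / p) + e" .
  qed
  then show "(\<Sum>\<^sub>\<infinity>i\<in>I. norm (f i + g i) powr p) powr (1 / p)
      \<le> (\<Sum>\<^sub>\<infinity>i\<in>I. norm (f i) powr p) powr (1 / p) + (\<Sum>\<^sub>\<infinity>i\<in>I. norm (g i) powr p) powr (1 / p)"
    unfolding F_def G_def .
qed

lemma b_bound_imp_nnorm_nonneg:
  assumes "b_bound nnorm a T M"
  shows "0 \<le> nnorm (x # a)"
proof -
  have "0 < M" "0 \<le> M * nnorm (x # a)"
    using assms norm_ge_zero order_trans unfolding b_bound_def by blast+
  then show ?thesis
    by (simp add: zero_le_mult_iff)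
qed

text \<open>The infimum that defines the norm of a functional is attained.\<close>

lemma norm_le_b_norm:
  assumes "T \<in> b_dual smul nnorm a"
  shows "norm (T (x # a)) \<le> b_norm nnorm a T * nnorm (x # a)"
proof -
  obtain M where M: "b_bound nnorm a T M"
    using assms by (auto simp: b_dual_def)
  show ?thesis
  proof (cases "nnorm (x # a) = 0")
    case True
    then show ?thesis
      using M unfolding b_bound_def by (metis mult_zero_right)
  next
    case False
    then have pos: "0 < nnorm (x # a)"
      using b_bound_imp_nnorm_nonneg[OF M, of x] by simp
    have "norm (T (x # a)) / nnorm (x # a) \<le> b_norm nnorm a T"
      unfolding b_norm_def
      using M pos by (intro cInf_greatest) (auto simp: b_bound_def pos_divide_le_eq)
    then show ?thesis
      using pos by (simp add: pos_divide_le_eq)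
  qed
qed

lemma b_norm_pos:
  assumes "T \<in> b_dual smul nnorm a" and "\<not> b_eq a T (\<lambda>_. 0)"
  shows "0 < b_norm nnorm a T"
proof -
  obtain M where M: "b_bound nnorm a T M"
    using assms(1) by (auto simp: b_dual_def)
  obtain x where "T (x # a) \<noteq> 0"
    using assms(2) by (auto simp: b_eq_def)
  then have "0 < b_norm nnorm a T * nnorm (x # a)"
    using norm_le_b_norm[OF assms(1), of x] by (meson less_le_trans zero_less_norm_iff)
  then show ?thesis
    using b_bound_imp_nnorm_nonneg[OF M, of x] by (auto simp: zero_less_mult_iff)
qed

lemma b_dual_add_scale:
  assumes "S \<in> b_dual smul nnorm a" and "T \<in> b_dual smul nnorm a"
  shows "(\<lambda>xs. S xs + c * T xs) \<in> b_dual smul nnorm a"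
proof -
  obtain M N where M: "b_bound nnorm a S M" and N: "b_bound nnorm a T N"
    using assms by (auto simp: b_dual_def)
  have "norm (S (x # a) + c * T (x # a)) \<le> (M + norm c * N) * nnorm (x # a)" for x
  proof -
    have "norm (S (x # a) + c * T (x # a)) \<le> norm (S (x # a)) + norm c * norm (T (x # a))"
      by (metis norm_mult norm_triangle_ineq)
    also have "\<dots> \<le> M * nnorm (x # a) + norm c * (N * nnorm (x # a))"
      using M N by (intro add_mono mult_left_mono) (auto simp: b_bound_def)
    finally show ?thesis
      by (simp add: algebra_simps)
  qed
  moreover have "0 < M + norm c * N"
    using M N by (simp add: b_bound_def add_pos_nonneg)
  ultimately have "b_bound nnorm a (\<lambda>xs. S xs + c * T xs) (M + norm c * N)"
    by (simp add: b_bound_def)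
  then show ?thesis
    using assms by (auto simp: b_dual_def algebra_simps)
qed

theorem theorem4p1:
  fixes smul :: "'k::real_normed_field \<Rightarrow> 'x::ab_group_add \<Rightarrow> 'x"
    and n :: nat and nnorm :: "'x list \<Rightarrow> real" and a :: "'x list"
    and p A B :: real and I :: "'i set"
    and T :: "'i \<Rightarrow> 'x list \<Rightarrow> 'k" and R :: "'x list \<Rightarrow> 'k" and c :: "'i \<Rightarrow> 'k"
  assumes "n_Banach_space smul n nnorm"
    and "length a = n - 1"
    and "1 < p"
    and "p_frame_with_bounds smul nnorm a p I T A B"
    and "R \<in> b_dual smul nnorm a"
    and "\<not> b_eq a R (\<lambda>_. 0)"
    and "(\<lambda>i. norm (c i) powr p) summable_on I"
    and "(\<Sum>\<^sub>\<infinity>i\<in>I. norm (c i) powr p) < A / b_norm nnorm a R powr p"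
  shows "p_frame smul nnorm a p I (\<lambda>i xs. T i xs + c i * R xs)"
proof -
  note p = \<open>1 < p\<close> and R = \<open>R \<in> b_dual smul nnorm a\<close>
  define r where "r = b_norm nnorm a R"
  define C where "C = (\<Sum>\<^sub>\<infinity>i\<in>I. norm (c i) powr p)"
  define \<gamma> where "\<gamma> = C powr (1 / p) * r"
  define \<alpha> where "\<alpha> = A powr (1 / p)"
  define \<beta> where "\<beta> = B powr (1 / p)"
  define N where "N f = (\<Sum>\<^sub>\<infinity>i\<in>I. norm (f i) powr p) powr (1 / p)" for f :: "'i \<Rightarrow> 'k"
  have "0 < A" "0 < B" and "countable I"
    and T_dual: "\<And>i. i \<in> I \<Longrightarrow> T i \<in> b_dual smul nnorm a"
    and T_summable: "\<And>x. (\<lambda>i. norm (T i (x # a)) powr p) summable_on I"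
    and T_ge: "\<And>x. A * nnorm (x # a) powr p \<le> (\<Sum>\<^sub>\<infinity>i\<in>I. norm (T i (x # a)) powr p)"
    and T_le: "\<And>x. (\<Sum>\<^sub>\<infinity>i\<in>I. norm (T i (x # a)) powr p) \<le> B * nnorm (x # a) powr p"
    using assms(4) by (auto simp: p_frame_with_bounds_def)
  have nonneg: "0 \<le> nnorm (x # a)" for x
    using R by (auto simp: b_dual_def dest: b_bound_imp_nnorm_nonneg)
  have r: "0 < r"
    unfolding r_def using R assms(6) by (rule b_norm_pos)
  have C: "0 \<le> C"
    unfolding C_def by (auto intro: infsum_nonneg)
  have \<gamma>: "0 \<le> \<gamma>"
    unfolding \<gamma>_def using r by simp
  have "C * r powr p < A"
    using assms(8) r unfolding C_def[symmetric] r_def[symmetric] by (simp add: pos_less_divide_eq)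
  then have "(C * r powr p) powr (1 / p) < A powr (1 / p)"
    using C p by (intro powr_less_mono2) auto
  then have \<gamma>_less: "\<gamma> < \<alpha>"
    using r p by (simp add: \<gamma>_def \<alpha>_def powr_mult powr_powr)
  have N_nonneg: "0 \<le> N f" for f
    by (simp add: N_def)
  have N_powr: "N f powr p = (\<Sum>\<^sub>\<infinity>i\<in>I. norm (f i) powr p)" for f
    using p by (simp add: N_def powr_powr infsum_nonneg)
  have powr_scale: "(K * nnorm (x # a) powr p) powr (1 / p) = K powr (1 / p) * nnorm (x # a)"
    for K x using p nonneg[of x] by (simp add: powr_mult powr_powr)
  have N_T: "\<alpha> * nnorm (x # a) \<le> N (\<lambda>i. T i (x # a))"
    "N (\<lambda>i. T i (x # a)) \<le> \<beta> * nnorm (x # a)" for x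
    using powr_mono2[OF _ _ T_ge[of x], of "1 / p"] powr_mono2[OF _ _ T_le[of x], of "1 / p"]
      p \<open>0 < A\<close> unfolding powr_scale N_def \<alpha>_def \<beta>_def by (auto simp: infsum_nonneg)
  have cR_summable: "(\<lambda>i. norm (c i * k) powr p) summable_on I" for k
    unfolding norm_mult powr_mult by (intro summable_on_cmult_left assms(7))
  have N_cR: "N (\<lambda>i. c i * R (x # a)) \<le> \<gamma> * nnorm (x # a)" for x
  proof -
    have "N (\<lambda>i. c i * R (x # a)) = (C * norm (R (x # a)) powr p) powr (1 / p)"
      unfolding N_def C_def norm_mult powr_mult by (simp add: infsum_cmult_left' powr_mult)
    also have "\<dots> = C powr (1 / p) * norm (R (x # a))"
      using p by (simp add: powr_mult powr_powr)
    also have "\<dots> \<le> C powr (1 / p) * (r * nnorm (x # a))"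
      unfolding r_def using norm_le_b_norm[OF R] by (intro mult_left_mono) auto
    finally show ?thesis
      by (simp add: \<gamma>_def mult.assoc)
  qed
  have summable: "(\<lambda>i. norm (T i (x # a) + c i * R (x # a)) powr p) summable_on I" for x
    using p by (intro Minkowski_summable_on T_summable cR_summable) auto
  have upper: "N (\<lambda>i. T i (x # a) + c i * R (x # a)) \<le> (\<beta> + \<gamma>) * nnorm (x # a)" for x
  proof -
    have "N (\<lambda>i. T i (x # a) + c i * R (x # a))
        \<le> N (\<lambda>i. T i (x # a)) + N (\<lambda>i. c i * R (x # a))"
      unfolding N_def using p by (intro Minkowski_infsum_le T_summable cR_summable) auto
    then show ?thesis
      using N_T(2)[of x] N_cR[of x] by (simp add: algebra_simps)
  qed
  have lower: "(\<alpha> - \<gamma>) * nnorm (x # a) \<le> N (\<lambda>i. T i (x # a) + c i * R (x # a))" for x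
  proof -
    have "N (\<lambda>i. (T i (x # a) + c i * R (x # a)) + - (c i * R (x # a)))
        \<le> N (\<lambda>i. T i (x # a) + c i * R (x # a)) + N (\<lambda>i. - (c i * R (x # a)))"
      unfolding N_def using p summable cR_summable
      by (intro Minkowski_infsum_le) (auto simp only: norm_minus_cancel less_imp_le)
    moreover have "N (\<lambda>i. - (c i * R (x # a))) = N (\<lambda>i. c i * R (x # a))"
      by (simp add: N_def)
    ultimately show ?thesis
      using N_T(1)[of x] N_cR[of x] by (simp add: algebra_simps)
  qed
  have "p_frame_with_bounds smul nnorm a p I (\<lambda>i xs. T i xs + c i * R xs)
      ((\<alpha> - \<gamma>) powr p) ((\<beta> + \<gamma>) powr p)"
    unfolding p_frame_with_bounds_def
  proof (intro conjI ballI allI)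
    show "countable I" by fact
    show "(\<lambda>xs. T i xs + c i * R xs) \<in> b_dual smul nnorm a" if "i \<in> I" for i
      using T_dual[OF that] R by (rule b_dual_add_scale)
    show "0 < (\<alpha> - \<gamma>) powr p"
      using \<gamma>_less by simp
    have "0 < \<beta>"
      unfolding \<beta>_def using \<open>0 < B\<close> by simp
    then show "0 < (\<beta> + \<gamma>) powr p"
      using \<gamma> by simp
    fix x
    show "(\<lambda>i. norm (T i (x # a) + c i * R (x # a)) powr p) summable_on I"
      by (rule summable)
    show "(\<alpha> - \<gamma>) powr p * nnorm (x # a) powr p
        \<le> (\<Sum>\<^sub>\<infinity>i\<in>I. norm (T i (x # a) + c i * R (x # a)) powr p)"
      using powr_mono2[OF _ _ lower[of x], of p] p \<gamma>_less nonneg[of x]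
      by (simp add: N_powr powr_mult)
    show "(\<Sum>\<^sub>\<infinity>i\<in>I. norm (T i (x # a) + c i * R (x # a)) powr p)
        \<le> (\<beta> + \<gamma>) powr p * nnorm (x # a) powr p"
      using powr_mono2[OF _ N_nonneg upper[of x], of p] p
      by (simp add: N_powr powr_mult)
  qed
  then show ?thesis
    unfolding p_frame_def by blast
qed

end
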